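(* Let $L>0$, $n\ge 1$, and let $f(\cdot;1),\dots,f(\cdot;n):\mathbb{R}^d\to\mathbb{R}$ be convex differentiable functions such that $\|\nabla f(x;i)-\nabla f(y;i)\|\le L\|x-y\|$ for all $x,y\in\mathbb{R}^d$ and $i\in\{1,\dots,n\}$. Let $F(w)=\frac1n\sum_{i=1}^n f(w;i)$, assume $F$ has a minimizer, let $x_*$ be any minimizer of $F$, and let $\sigma_*^2=\frac1n\sum_{i=1}^n\|\nabla f(x_*;i)\|^2$. Let $T\ge 2$ be an integer, $\alpha=1+\frac1T$, $k=\frac{1}{e\,\alpha\,\sqrt[3]{12}}$. Run the NASG algorithm for $T$ epochs from a (deterministic) initial point $\tilde y_0=\tilde x_0\in\mathbb{R}^d$ under a randomized scheme (Random Reshuffling or Single Shuffling), with momentum parameters $\gamma_t=\frac{t-1}{t+2}$ and learning rates $\eta_i^{(t)}=\frac{\eta_t}{n}>0$, where $\eta_t=\frac{k\alpha^t}{LT}\le\frac1L$. Then $$\mathbb{E}[F(\tilde x_T)-F(x_* )]\le \frac{8\sigma_*^2}{27nLT}+\frac{2Le\sqrt[3]{12}}{T}\,\|\tilde x_0-x_*\|^2 .$$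
   Context: NASG (Nesterov Accelerated Shuffling Gradient) algorithm: given initial points $\tilde x_0,\tilde y_0\in\mathbb{R}^d$, parameters $\gamma_t$ and learning rates $\eta_i^{(t)}>0$, for each epoch $t=1,2,\dots,T$: set $y_0^{(t)}:=\tilde y_{t-1}$; choose a permutation $\pi^{(t)}$ of $\{1,\dots,n\}$; for $i=1,\dots,n$ set $y_i^{(t)}:=y_{i-1}^{(t)}-\eta_i^{(t)}\nabla f(y_{i-1}^{(t)};\pi^{(t)}(i))$; then set $\tilde x_t:=y_n^{(t)}$ and $\tilde y_t:=\tilde x_t+\gamma_t(\tilde x_t-\tilde x_{t-1})$. Randomized schemes: Random Reshuffling means a new uniformly random permutation $\pi^{(t)}$ is drawn independently at the beginning of each epoch; Single Shuffling means a single uniformly random permutation is drawn at the start and used in every epoch. $\mathbb{E}$ is the expectation over the random permutation(s); $e$ is Euler's number. *)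

theory Defs
  imports "HOL-Analysis.Analysis" "HOL-Probability.Probability"
begin

definition gradient :: "('a::real_inner \<Rightarrow> real) \<Rightarrow> 'a \<Rightarrow> 'a" where
  "gradient f x = (THE D. GDERIV f x :> D)"

definition finite_sum_objective :: "nat \<Rightarrow> (nat \<Rightarrow> 'a \<Rightarrow> real) \<Rightarrow> 'a \<Rightarrow> real" where
  "finite_sum_objective n f w = (1 / real n) * (\<Sum>i = 1..n. f i w)"

definition gradient_variance :: "nat \<Rightarrow> (nat \<Rightarrow> 'a::real_inner \<Rightarrow> real) \<Rightarrow> 'a \<Rightarrow> real" where
  "gradient_variance n f x = (1 / real n) * (\<Sum>i = 1..n. (norm (gradient (f i) x))\<^sup>2)"

primrec inner_iterate ::
  "(nat \<Rightarrow> 'a::real_inner \<Rightarrow> real) \<Rightarrow> (nat \<Rightarrow> real) \<Rightarrow> (nat \<Rightarrow> nat) \<Rightarrow> 'a \<Rightarrow> nat \<Rightarrow> 'a" where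
  "inner_iterate f h p y\<^sub>0 0 = y\<^sub>0"
| "inner_iterate f h p y\<^sub>0 (Suc i) =
     inner_iterate f h p y\<^sub>0 i -
       h (Suc i) *\<^sub>R gradient (f (p (Suc i))) (inner_iterate f h p y\<^sub>0 i)"

(* The state after t epochs is the pair (x_t, y_t) of outer iterates. The step size of
   inner step i in epoch t is \<eta> t i, and \<pi> t is the permutation used in epoch t;
   epochs and inner steps are numbered from 1. *)
primrec nasg ::
  "nat \<Rightarrow> (nat \<Rightarrow> 'a::real_inner \<Rightarrow> real) \<Rightarrow> (nat \<Rightarrow> real) \<Rightarrow> (nat \<Rightarrow> nat \<Rightarrow> real) \<Rightarrow>
   'a \<Rightarrow> 'a \<Rightarrow> (nat \<Rightarrow> nat \<Rightarrow> nat) \<Rightarrow> nat \<Rightarrow> 'a \<times> 'a" where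
  "nasg n f \<gamma> \<eta> x\<^sub>0 y\<^sub>0 \<pi> 0 = (x\<^sub>0, y\<^sub>0)"
| "nasg n f \<gamma> \<eta> x\<^sub>0 y\<^sub>0 \<pi> (Suc t) =
     (let (x, y) = nasg n f \<gamma> \<eta> x\<^sub>0 y\<^sub>0 \<pi> t;
          x' = inner_iterate f (\<eta> (Suc t)) (\<pi> (Suc t)) y n
      in (x', x' + \<gamma> (Suc t) *\<^sub>R (x' - x)))"

definition uniform_permutation :: "nat \<Rightarrow> (nat \<Rightarrow> nat) pmf" where
  "uniform_permutation n = pmf_of_set {p. p permutes {1..n}}"

datatype shuffling_scheme = Random_Reshuffling | Single_Shuffling

(* Joint law of the permutations of epochs 1..T. Under Random_Reshuffling they are
   independent; the default value id is only taken outside {1..T}. *)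
fun shuffling_law :: "shuffling_scheme \<Rightarrow> nat \<Rightarrow> nat \<Rightarrow> (nat \<Rightarrow> nat \<Rightarrow> nat) pmf" where
  "shuffling_law Random_Reshuffling n T = Pi_pmf {1..T} id (\<lambda>_. uniform_permutation n)"
| "shuffling_law Single_Shuffling n T = map_pmf (\<lambda>p _. p) (uniform_permutation n)"

end

theory Submission
  imports Defs
begin

text \<open>Compare the function values after an epoch with the component tangents at the inner iterates:
  the epoch acts as one Nesterov step of length \<open>\<eta>\<^sub>t\<close>, up to the drift of the inner iterates.
  Splitting the sampled gradients at the minimizer, the iterate-dependent part of the drift is
  absorbed by cocoercivity, because \<open>(L \<eta>\<^sub>t)\<^sup>2\<close> is far below \<open>1 / (t + 1)\<close>. What remains are partial
  sums of the gradients at the minimizer along the permutation of a single epoch, so only its uniform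
  marginal law matters and both schemes are treated alike. Sampling without replacement from vectors
  with sum zero gives nonpositive correlations, which yields the factor \<open>1 / n\<close>.\<close>

section \<open>Smooth convex functions\<close>

text \<open>Justifies the definite description in \<open>gradient\<close>. A linear functional is
  the inner product with the vector of its values on the basis, and the representing vector is
  unique: test two candidates on their difference.\<close>

lemma GDERIV_gradient:
  fixes f :: "'a::euclidean_space \<Rightarrow> real"
  assumes "f differentiable (at x)"
  shows "GDERIV f x :> gradient f x"
proof -
  obtain f' where f': "(f has_derivative f') (at x)"
    using assms by (auto simp: differentiable_def)
  interpret linear f' using f' by (rule has_derivative_linear)
  define D where "D = (\<Sum>b\<in>Basis. f' b *\<^sub>R b)"
  have "f' h = h \<bullet> D" for h
  proof -
    have "f' h = f' (\<Sum>b\<in>Basis. (h \<bullet> b) *\<^sub>R b)" by (simp add: euclidean_representation)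
    also have "\<dots> = h \<bullet> D" by (simp add: sum scale D_def inner_sum_right mult.commute)
    finally show ?thesis .
  qed
  then have "f' = (\<lambda>h. h \<bullet> D)" by (rule ext)
  with f' have D: "GDERIV f x :> D" by (simp add: gderiv_def)
  show ?thesis unfolding gradient_def
  proof (rule theI)
    show "GDERIV f x :> D" by fact
    fix E assume "GDERIV f x :> E"
    with D have "(\<lambda>h. h \<bullet> E) = (\<lambda>h. h \<bullet> D)"
      unfolding gderiv_def by (metis has_derivative_unique)
    then have "(E - D) \<bullet> E = (E - D) \<bullet> D" by metis
    then have "(E - D) \<bullet> (E - D) = 0" by (simp add: inner_diff_right)
    then show "E = D" by simp
  qed
qed

lemma has_real_derivative_along_line:
  fixes f :: "'a::euclidean_space \<Rightarrow> real"
  assumes "\<And>x. f differentiable (at x)"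
  shows "((\<lambda>t. f (x + t *\<^sub>R d)) has_real_derivative gradient f (x + t *\<^sub>R d) \<bullet> d) (at t)"
proof -
  have "((\<lambda>t. x + t *\<^sub>R d) has_derivative (\<lambda>s. s *\<^sub>R d)) (at t)"
    by (auto intro!: derivative_eq_intros)
  moreover have "(f has_derivative (\<lambda>h. h \<bullet> gradient f (x + t *\<^sub>R d))) (at (x + t *\<^sub>R d))"
    using GDERIV_gradient[OF assms] by (simp add: gderiv_def)
  ultimately have "((\<lambda>t. f (x + t *\<^sub>R d)) has_derivative (\<lambda>s. (s *\<^sub>R d) \<bullet> gradient f (x + t *\<^sub>R d))) (at t)"
    by (rule has_derivative_compose)
  then show ?thesis
    by (simp add: has_field_derivative_def inner_commute mult.commute[of _ "d \<bullet> _"] mult_commute_abs)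
qed

text \<open>Restriction to the line through \<open>x\<close> and \<open>y\<close> reduces this to
  the one-dimensional tangent inequality at parameter 0.\<close>

lemma convex_on_above_gradient:
  fixes f :: "'a::euclidean_space \<Rightarrow> real"
  assumes convex: "convex_on UNIV f" and diff: "\<And>x. f differentiable (at x)"
  shows "f x + gradient f x \<bullet> (y - x) \<le> f y"
proof -
  define h where "h = (\<lambda>t. f (x + t *\<^sub>R (y - x)))"
  have "convex_on UNIV h"
  proof (rule convex_onI)
    fix u a b :: real
    assume u: "0 < u" "u < 1"
    have "x + ((1 - u) *\<^sub>R a + u *\<^sub>R b) *\<^sub>R (y - x)
        = (1 - u) *\<^sub>R (x + a *\<^sub>R (y - x)) + u *\<^sub>R (x + b *\<^sub>R (y - x))"
      by (simp add: algebra_simps)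
    then show "h ((1 - u) *\<^sub>R a + u *\<^sub>R b) \<le> (1 - u) * h a + u * h b"
      unfolding h_def using convex_onD[OF convex, of u] u by simp
  qed simp
  moreover have "(h has_real_derivative gradient f x \<bullet> (y - x)) (at 0)"
    using has_real_derivative_along_line[OF diff, of x "y - x" 0] by (simp add: h_def)
  ultimately have "h 1 - h 0 \<ge> (gradient f x \<bullet> (y - x)) * (1 - 0)"
    by (intro convex_on_imp_above_tangent[where A = UNIV]) auto
  then show ?thesis by (simp add: h_def)
qed

text \<open>No integral is taken: along the segment, \<open>f\<close> minus its quadratic upper
  model is \<open>h\<close>, whose derivative is nonpositive by Cauchy-Schwarz and the Lipschitz
  bound.\<close>

lemma smooth_descent:
  fixes f :: "'a::euclidean_space \<Rightarrow> real"
  assumes diff: "\<And>x. f differentiable (at x)"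
    and smooth: "\<And>x y. norm (gradient f x - gradient f y) \<le> L * norm (x - y)"
  shows "f y \<le> f x + gradient f x \<bullet> (y - x) + L / 2 * (norm (y - x))\<^sup>2"
proof -
  define d where "d = y - x"
  define h where "h = (\<lambda>t. f (x + t *\<^sub>R d) - t * (gradient f x \<bullet> d) - L / 2 * t\<^sup>2 * (norm d)\<^sup>2)"
  have "h 1 \<le> h 0"
  proof (rule DERIV_nonpos_imp_nonincreasing[of 0 1])
    fix t :: real assume t: "0 \<le> t"
    have "(h has_real_derivative gradient f (x + t *\<^sub>R d) \<bullet> d - gradient f x \<bullet> d - L * t * (norm d)\<^sup>2) (at t)"
      unfolding h_def
      by (auto intro!: derivative_eq_intros has_real_derivative_along_line[OF diff])
    moreover have "gradient f (x + t *\<^sub>R d) \<bullet> d - gradient f x \<bullet> d \<le> L * t * (norm d)\<^sup>2"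
    proof -
      have "gradient f (x + t *\<^sub>R d) \<bullet> d - gradient f x \<bullet> d
          \<le> norm (gradient f (x + t *\<^sub>R d) - gradient f x) * norm d"
        by (metis inner_diff_left norm_cauchy_schwarz)
      also have "\<dots> \<le> (L * norm (t *\<^sub>R d)) * norm d"
        using smooth[of "x + t *\<^sub>R d" x] by (intro mult_right_mono) auto
      finally show ?thesis using t by (simp add: power2_eq_square)
    qed
    ultimately show "\<exists>D. (h has_real_derivative D) (at t) \<and> D \<le> 0"
      by (intro exI[of _ "_ - _"] conjI) (assumption, simp)
  qed simp
  then show ?thesis by (simp add: h_def d_def)
qed

text \<open>The value \<open>f w\<close> is squeezed between the tangent at \<open>y\<close> and the
  quadratic upper model at \<open>z\<close>. The choice of \<open>w\<close> minimizes the difference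
  of the two bounds, which produces the squared gradient gap.\<close>

lemma convex_smooth_cocoercive:
  fixes f :: "'a::euclidean_space \<Rightarrow> real"
  assumes "L > 0" and convex: "convex_on UNIV f" and diff: "\<And>x. f differentiable (at x)"
    and smooth: "\<And>x y. norm (gradient f x - gradient f y) \<le> L * norm (x - y)"
  shows "f y + gradient f y \<bullet> (z - y) + (norm (gradient f y - gradient f z))\<^sup>2 / (2 * L) \<le> f z"
proof -
  define e where "e = gradient f z - gradient f y"
  define w where "w = z - (1 / L) *\<^sub>R e"
  have "f y + gradient f y \<bullet> (w - y) \<le> f w"
    by (rule convex_on_above_gradient[OF convex diff])
  also have "\<dots> \<le> f z + gradient f z \<bullet> (w - z) + L / 2 * (norm (w - z))\<^sup>2"
    by (rule smooth_descent[OF diff smooth])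
  finally have "f y + gradient f y \<bullet> (z - y) \<le> f z + e \<bullet> (w - z) + L / 2 * (norm (w - z))\<^sup>2"
    by (simp add: e_def algebra_simps)
  also have "e \<bullet> (w - z) = - ((norm e)\<^sup>2 / L)"
    by (simp add: w_def power2_norm_eq_inner)
  also have "L / 2 * (norm (w - z))\<^sup>2 = (norm e)\<^sup>2 / (2 * L)"
    using \<open>L > 0\<close> by (simp add: w_def power_mult_distrib power2_eq_square field_simps)
  finally show ?thesis
    using \<open>L > 0\<close> by (simp add: e_def norm_minus_commute field_simps)
qed

text \<open>First-order optimality, in the form that makes the gradients at the minimizer a centred
  population for sampling without replacement.\<close>

lemma sum_gradient_minimizer_eq_0:
  fixes f :: "nat \<Rightarrow> 'a::euclidean_space \<Rightarrow> real"
  assumes "n \<ge> 1" and diff: "\<And>i x. i \<in> {1..n} \<Longrightarrow> f i differentiable (at x)"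
    and min: "\<And>w. finite_sum_objective n f z \<le> finite_sum_objective n f w"
  shows "(\<Sum>i = 1..n. gradient (f i) z) = 0"
proof -
  define G where "G = (\<Sum>i = 1..n. gradient (f i) z)"
  have "((\<lambda>w. \<Sum>i = 1..n. f i w) has_derivative (\<lambda>h. \<Sum>i = 1..n. h \<bullet> gradient (f i) z)) (at z)"
    using GDERIV_gradient[OF diff] by (intro has_derivative_sum) (simp add: gderiv_def)
  moreover have "(\<Sum>i = 1..n. f i z) \<le> (\<Sum>i = 1..n. f i w)" for w
    using min[of w] \<open>n \<ge> 1\<close> by (simp add: finite_sum_objective_def divide_right_mono field_simps)
  ultimately have "(\<lambda>h. \<Sum>i = 1..n. h \<bullet> gradient (f i) z) = (\<lambda>h. 0)"
    by (intro differential_zero_maxmin[of z UNIV]) auto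
  \<comment> \<open>The vanishing functional is evaluated at \<open>G\<close> itself.\<close>
  then have "G \<bullet> G = 0"
    unfolding G_def inner_sum_right by (metis (no_types))
  then show ?thesis by (simp add: G_def)
qed

section \<open>Partial sums over a uniformly random permutation\<close>

lemma finite_set_pmf_uniform_permutation: "finite (set_pmf (uniform_permutation n))"
  unfolding uniform_permutation_def
  by (subst set_pmf_of_set) (auto simp: finite_permutations intro: permutes_id)

lemma set_pmf_uniform_permutation: "set_pmf (uniform_permutation n) = {p. p permutes {1..n}}"
  unfolding uniform_permutation_def
  by (subst set_pmf_of_set) (auto simp: finite_permutations intro: permutes_id)

lemma integrable_uniform_permutation:
  fixes g :: "(nat \<Rightarrow> nat) \<Rightarrow> real"
  shows "integrable (measure_pmf (uniform_permutation n)) g"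
  by (rule integrable_measure_pmf_finite[OF finite_set_pmf_uniform_permutation])

text \<open>Exchangeability of positions: right composition with \<open>q\<close> is a bijection of
  the symmetric group, so it preserves the uniform law. It is applied below to
  transpositions.\<close>

lemma expectation_uniform_permutation_comp:
  fixes g :: "(nat \<Rightarrow> nat) \<Rightarrow> real"
  assumes "q permutes {1..n}"
  shows "measure_pmf.expectation (uniform_permutation n) (\<lambda>p. g (p \<circ> q))
       = measure_pmf.expectation (uniform_permutation n) g"
proof -
  have "bij_betw (\<lambda>p. p \<circ> q) {p. p permutes {1..n}} {p. p permutes {1..n}}"
    using assms
    by (intro bij_betwI[where g = "\<lambda>p. p \<circ> inv q"])
       (auto simp: permutes_compose permutes_inv o_assoc[symmetric] permutes_inv_o)
  then have "map_pmf (\<lambda>p. p \<circ> q) (uniform_permutation n) = uniform_permutation n"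
    unfolding uniform_permutation_def
    by (intro map_pmf_of_set_bij_betw) (auto simp: finite_permutations intro: permutes_id)
  then show ?thesis
    by (metis integral_map_pmf)
qed

text \<open>All positions share one expectation by a swap, and the sum over positions is the same
  for every permutation; dividing by \<open>n\<close> gives the mean.\<close>

lemma expectation_uniform_permutation_apply:
  fixes g :: "nat \<Rightarrow> real"
  assumes "j \<in> {1..n}"
  shows "measure_pmf.expectation (uniform_permutation n) (\<lambda>p. g (p j)) = (1 / real n) * (\<Sum>i = 1..n. g i)"
proof -
  let ?E = "measure_pmf.expectation (uniform_permutation n)"
  have eq: "?E (\<lambda>p. g (p l)) = ?E (\<lambda>p. g (p j))" if "l \<in> {1..n}" for l
    using expectation_uniform_permutation_comp[OF permutes_swap_id[OF assms that], of "\<lambda>p. g (p j)"]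
    by simp
  have "real n * ?E (\<lambda>p. g (p j)) = (\<Sum>l = 1..n. ?E (\<lambda>p. g (p l)))"
    using eq by simp
  also have "\<dots> = ?E (\<lambda>p. \<Sum>l = 1..n. g (p l))"
    by (rule Bochner_Integration.integral_sum[symmetric]) (rule integrable_uniform_permutation)
  also have "\<dots> = ?E (\<lambda>p. \<Sum>l = 1..n. g l)"
    by (intro integral_cong_AE)
       (auto simp: AE_measure_pmf_iff set_pmf_uniform_permutation intro: sum.permute[symmetric, unfolded o_def])
  also have "\<dots> = (\<Sum>l = 1..n. g l)" by simp
  finally show ?thesis using assms by (auto simp: field_simps)
qed

text \<open>By exchangeability all off-diagonal covariances agree, and since \<open>a\<close> sums to zero those
  in one row add up to minus a second moment; hence they are nonpositive.\<close>

lemma expectation_norm_sum_permutation_le: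
  fixes a :: "nat \<Rightarrow> 'a::real_inner"
  assumes zero: "(\<Sum>i = 1..n. a i) = 0" and J: "J \<subseteq> {1..n}"
  shows "measure_pmf.expectation (uniform_permutation n) (\<lambda>p. (norm (\<Sum>j\<in>J. a (p j)))\<^sup>2)
       \<le> real (card J) * ((1 / real n) * (\<Sum>i = 1..n. (norm (a i))\<^sup>2))"
proof -
  let ?E = "measure_pmf.expectation (uniform_permutation n)"
  let ?v = "(1 / real n) * (\<Sum>i = 1..n. (norm (a i))\<^sup>2)"
  define c where "c = (\<lambda>j l. ?E (\<lambda>p. a (p j) \<bullet> a (p l)))"
  have diag: "c j j = ?v" if "j \<in> {1..n}" for j
    using expectation_uniform_permutation_apply[OF that, of "\<lambda>i. (norm (a i))\<^sup>2"]
    by (simp add: c_def power2_norm_eq_inner)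
  have off: "c j l \<le> 0" if j: "j \<in> {1..n}" and l: "l \<in> {1..n}" and "j \<noteq> l" for j l
  proof -
    \<comment> \<open>Swapping positions \<open>m\<close> and \<open>l\<close> leaves position
      \<open>j\<close> fixed.\<close>
    have eq: "c j m = c j l" if m: "m \<in> {1..n} - {j}" for m
    proof -
      have "Transposition.transpose m l permutes {1..n}"
        using l m by (intro permutes_swap_id) auto
      from expectation_uniform_permutation_comp[OF this, of "\<lambda>p. a (p j) \<bullet> a (p m)"]
      show ?thesis using \<open>j \<noteq> l\<close> m by (simp add: c_def transpose_apply_other)
    qed
    have "(\<Sum>m = 1..n. c j m) = ?E (\<lambda>p. \<Sum>m = 1..n. a (p j) \<bullet> a (p m))"
      unfolding c_def
      by (rule Bochner_Integration.integral_sum[symmetric]) (rule integrable_uniform_permutation)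
    also have "\<dots> = ?E (\<lambda>p. 0)"
    proof (intro integral_cong_AE)
      have "(\<Sum>m = 1..n. a (p j) \<bullet> a (p m)) = 0" if "p permutes {1..n}" for p
      proof -
        have "(\<Sum>m = 1..n. a (p m)) = 0"
          using sum.permute[OF that, of a] zero by (simp add: o_def)
        then show ?thesis by (simp flip: inner_sum_right)
      qed
      then show "AE p in measure_pmf (uniform_permutation n). (\<Sum>m = 1..n. a (p j) \<bullet> a (p m)) = 0"
        by (simp add: AE_measure_pmf_iff set_pmf_uniform_permutation)
    qed auto
    finally have "c j j + (\<Sum>m \<in> {1..n} - {j}. c j m) = 0"
      using j by (simp add: sum.remove)
    moreover have "(\<Sum>m \<in> {1..n} - {j}. c j m) = real (n - 1) * c j l"
      using eq j by simp
    moreover have "c j j \<ge> 0"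
      unfolding c_def by (intro integral_nonneg_AE) auto
    ultimately have "real (n - 1) * c j l \<le> 0" by linarith
    \<comment> \<open>Two distinct positions force \<open>n\<close> to be at least 2, so the factor
      can be cancelled.\<close>
    moreover have "real (n - 1) > 0" using j l \<open>j \<noteq> l\<close> by auto
    ultimately show ?thesis by (simp add: mult_le_0_iff)
  qed
  have "?E (\<lambda>p. (norm (\<Sum>j\<in>J. a (p j)))\<^sup>2) = ?E (\<lambda>p. \<Sum>j\<in>J. \<Sum>l\<in>J. a (p j) \<bullet> a (p l))"
    by (simp add: power2_norm_eq_inner inner_sum_left inner_sum_right inner_commute)
  also have "\<dots> = (\<Sum>j\<in>J. \<Sum>l\<in>J. c j l)"
    by (simp add: c_def Bochner_Integration.integral_sum integrable_uniform_permutation)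
  \<comment> \<open>Off-diagonal covariances are raised to 0, so only the diagonal survives.\<close>
  also have "\<dots> \<le> (\<Sum>j\<in>J. \<Sum>l\<in>J. if l = j then ?v else 0)"
    using J diag off by (intro sum_mono) (auto simp: subset_eq)
  also have "\<dots> = (\<Sum>j\<in>J. ?v)"
    using finite_subset[OF J] by (intro sum.cong) auto
  finally show ?thesis by simp
qed

text \<open>Tails appear because the drift of an inner iterate is measured from the end of its
  epoch. Each of the \<open>n\<close> tails has at most \<open>n\<close> terms; without the zero
  sum, the bound would lose a further factor \<open>n\<close>.\<close>

lemma expectation_tail_sums_permutation_le:
  fixes a :: "nat \<Rightarrow> 'a::real_inner"
  assumes zero: "(\<Sum>i = 1..n. a i) = 0"
  shows "measure_pmf.expectation (uniform_permutation n)
           (\<lambda>p. \<Sum>i<n. (norm (\<Sum>j\<in>{i..<n}. a (p (Suc j))))\<^sup>2)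
       \<le> (real n)\<^sup>2 * ((1 / real n) * (\<Sum>i = 1..n. (norm (a i))\<^sup>2))"
proof -
  let ?E = "measure_pmf.expectation (uniform_permutation n)"
  let ?v = "(1 / real n) * (\<Sum>i = 1..n. (norm (a i))\<^sup>2)"
  have v: "0 \<le> ?v" by (simp add: sum_nonneg)
  have "?E (\<lambda>p. \<Sum>i<n. (norm (\<Sum>j\<in>{i..<n}. a (p (Suc j))))\<^sup>2)
      = (\<Sum>i<n. ?E (\<lambda>p. (norm (\<Sum>j\<in>{i..<n}. a (p (Suc j))))\<^sup>2))"
    by (intro Bochner_Integration.integral_sum integrable_uniform_permutation)
  also have "\<dots> \<le> (\<Sum>i<n. real n * ?v)"
  proof (rule sum_mono)
    fix i
    have "(\<Sum>j\<in>{i..<n}. a (p (Suc j))) = (\<Sum>j\<in>{Suc i..n}. a (p j))" for p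
      using sum.shift_bounds_Suc_ivl[of "\<lambda>j. a (p j)" i n]
      by (simp only: atLeastLessThanSuc_atLeastAtMost)
    then have "?E (\<lambda>p. (norm (\<Sum>j\<in>{i..<n}. a (p (Suc j))))\<^sup>2)
        = ?E (\<lambda>p. (norm (\<Sum>j\<in>{Suc i..n}. a (p j)))\<^sup>2)"
      by simp
    also have "\<dots> \<le> real (card {Suc i..n}) * ?v"
      by (rule expectation_norm_sum_permutation_le[OF zero]) auto
    also have "\<dots> \<le> real n * ?v"
      using v by (intro mult_right_mono) auto
    finally show "?E (\<lambda>p. (norm (\<Sum>j\<in>{i..<n}. a (p (Suc j))))\<^sup>2) \<le> real n * ?v" .
  qed
  also have "\<dots> = (real n)\<^sup>2 * ?v" by (simp add: power2_eq_square)
  finally show ?thesis .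
qed


section \<open>One epoch\<close>

lemma inner_iterate_eq_sum:
  "inner_iterate f (\<lambda>_. c) p y i
     = y - c *\<^sub>R (\<Sum>j<i. gradient (f (p (Suc j))) (inner_iterate f (\<lambda>_. c) p y j))"
  by (induction i) (auto simp: algebra_simps)

lemma norm_sum_squared_le:
  fixes u :: "'b \<Rightarrow> 'a::real_normed_vector"
  shows "(norm (\<Sum>i\<in>I. u i))\<^sup>2 \<le> real (card I) * (\<Sum>i\<in>I. (norm (u i))\<^sup>2)"
proof -
  have "(norm (\<Sum>i\<in>I. u i))\<^sup>2 \<le> (\<Sum>i\<in>I. norm (u i))\<^sup>2"
    by (intro power_mono norm_sum) auto
  also have "\<dots> \<le> (\<Sum>i\<in>I. (norm (u i))\<^sup>2) * real (card I)"
    by (rule sum_squared_le_sum_of_squares)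
  finally show ?thesis by (simp add: mult.commute)
qed

lemma norm_add_squared_le:
  fixes u v :: "'a::real_normed_vector"
  shows "(norm (u + v))\<^sup>2 \<le> 2 * ((norm u)\<^sup>2 + (norm v)\<^sup>2)"
proof -
  have "(norm (u + v))\<^sup>2 \<le> (norm u + norm v)\<^sup>2"
    by (intro power_mono norm_triangle_ineq) auto
  also have "\<dots> \<le> 2 * ((norm u)\<^sup>2 + (norm v)\<^sup>2)"
    using sum_squares_bound[of "norm u" "norm v"] by (simp add: power2_sum)
  finally show ?thesis .
qed

text \<open>The cocoercivity gain \<open>\<theta> \<Delta> / (2 L)\<close> obtained from comparing with \<open>z\<close> absorbs the part of the
  drift inside the epoch that depends on the iterates; only the gradients at \<open>z\<close> remain.\<close>

lemma epoch_descent: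
  fixes f :: "nat \<Rightarrow> 'a::euclidean_space \<Rightarrow> real"
  assumes "L > 0" "n \<ge> 1" "\<eta> > 0" and \<theta>: "0 \<le> \<theta>" "\<theta> \<le> 1" "(L * \<eta>)\<^sup>2 \<le> \<theta> / 2"
    and convex: "\<And>i. i \<in> {1..n} \<Longrightarrow> convex_on UNIV (f i)"
    and diff: "\<And>i x. i \<in> {1..n} \<Longrightarrow> f i differentiable (at x)"
    and smooth: "\<And>i x y. i \<in> {1..n} \<Longrightarrow>
          norm (gradient (f i) x - gradient (f i) y) \<le> L * norm (x - y)"
    and p: "p permutes {1..n}"
    and x'_def: "x' = inner_iterate f (\<lambda>_. \<eta> / real n) p y n"
  shows "finite_sum_objective n f x' - (1 - \<theta>) * finite_sum_objective n f x
           - \<theta> * finite_sum_objective n f z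
    \<le> (1 / \<eta>) * ((y - x') \<bullet> (x' - (1 - \<theta>) *\<^sub>R x - \<theta> *\<^sub>R z))
      + L * \<eta>\<^sup>2 / real n ^ 3 * (\<Sum>i<n. (norm (\<Sum>j\<in>{i..<n}. gradient (f (p (Suc j))) z))\<^sup>2)"
proof -
  define c where "c = \<eta> / real n"
  define Y where "Y = inner_iterate f (\<lambda>_. c) p y"
  define g where "g = (\<lambda>i. f (p (Suc i)))"
  define G where "G = (\<lambda>i. gradient (g i) (Y i))"
  define a where "a = (\<lambda>i. gradient (g i) z)"
  define u where "u = x' - (1 - \<theta>) *\<^sub>R x - \<theta> *\<^sub>R z"
  define \<Delta> where "\<Delta> = (\<Sum>i<n. (norm (G i - a i))\<^sup>2)"
  define S where "S = (\<Sum>i<n. (norm (\<Sum>j\<in>{i..<n}. a j))\<^sup>2)"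
  have n: "real n > 0" using \<open>n \<ge> 1\<close> by simp
  have x': "x' = Y n" by (simp add: x'_def Y_def c_def)
  have Y: "Y i = y - c *\<^sub>R (\<Sum>j<i. G j)" for i
    unfolding Y_def G_def g_def by (rule inner_iterate_eq_sum)
  \<comment> \<open>What separates \<open>Y i\<close> from the end of the epoch is exactly the
    gradients still to be applied.\<close>
  have drift: "x' - Y i = - (c *\<^sub>R (\<Sum>j\<in>{i..<n}. G j))" if "i \<le> n" for i
  proof -
    have "(\<Sum>j<n. G j) = (\<Sum>j<i. G j) + (\<Sum>j\<in>{i..<n}. G j)"
      using that by (simp add: lessThan_atLeast0 sum.atLeastLessThan_concat)
    then show ?thesis by (simp add: x' Y algebra_simps)
  qed
  have idx: "p (Suc i) \<in> {1..n}" if "i < n" for i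
    using permutes_in_image[OF p, of "Suc i"] that by simp
  have objective: "(\<Sum>i<n. g i w) = real n * finite_sum_objective n f w" for w
  proof -
    have "(\<Sum>i<n. g i w) = (\<Sum>i = 1..n. f (p i) w)"
      unfolding g_def by (rule sum.reindex_bij_witness[of _ "\<lambda>i. i - 1" Suc]) auto
    also have "\<dots> = (\<Sum>i = 1..n. f i w)"
      using sum.permute[OF p, of "\<lambda>i. f i w"] by (simp add: o_def)
    finally show ?thesis using n by (simp add: finite_sum_objective_def)
  qed
  \<comment> \<open>Three bounds based at \<open>Y i\<close>: descent towards \<open>x'\<close>,
    tangent towards \<open>x\<close>, cocoercivity towards \<open>z\<close>. The weights 1, -(1 -
    \<theta>), -\<theta> add up to 0, so \<open>g i (Y i)\<close> cancels.\<close>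
  have step: "g i x' - (1 - \<theta>) * g i x - \<theta> * g i z
      \<le> G i \<bullet> u + L / 2 * (norm (x' - Y i))\<^sup>2 - \<theta> / (2 * L) * (norm (G i - a i))\<^sup>2"
    if "i < n" for i
  proof -
    note ass = convex[OF idx[OF that]] diff[OF idx[OF that]]
    have 1: "g i x' \<le> g i (Y i) + G i \<bullet> (x' - Y i) + L / 2 * (norm (x' - Y i))\<^sup>2"
      unfolding G_def g_def by (rule smooth_descent[OF ass(2) smooth[OF idx[OF that]]])
    have 2: "(1 - \<theta>) * (g i (Y i) + G i \<bullet> (x - Y i)) \<le> (1 - \<theta>) * g i x"
      unfolding G_def g_def using \<theta>
      by (intro mult_left_mono convex_on_above_gradient[OF ass(1) ass(2)]) auto
    have 3: "\<theta> * (g i (Y i) + G i \<bullet> (z - Y i) + (norm (G i - a i))\<^sup>2 / (2 * L)) \<le> \<theta> * g i z"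
      unfolding G_def g_def a_def using \<theta>
      by (intro mult_left_mono convex_smooth_cocoercive[OF \<open>L > 0\<close> ass(1) ass(2) smooth[OF idx[OF that]]]) auto
    have "G i \<bullet> u = G i \<bullet> (x' - Y i) - (1 - \<theta>) * (G i \<bullet> (x - Y i)) - \<theta> * (G i \<bullet> (z - Y i))"
      by (simp add: u_def inner_diff_right algebra_simps)
    then show ?thesis using 1 2 3 by (simp add: algebra_simps)
  qed
  \<comment> \<open>Each \<open>G j\<close> is split as \<open>(G j - a j) + a j\<close>: the first
    part is controlled by \<open>\<Delta>\<close>, the second depends only on \<open>z\<close> and
    the permutation.\<close>
  have dist: "(norm (x' - Y i))\<^sup>2 \<le> 2 * c\<^sup>2 * (real n * \<Delta> + (norm (\<Sum>j\<in>{i..<n}. a j))\<^sup>2)"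
    if "i < n" for i
  proof -
    have "(norm (\<Sum>j\<in>{i..<n}. G j - a j))\<^sup>2
        \<le> real (card {i..<n}) * (\<Sum>j\<in>{i..<n}. (norm (G j - a j))\<^sup>2)"
      by (rule norm_sum_squared_le)
    also have "\<dots> \<le> real n * \<Delta>"
      unfolding \<Delta>_def by (intro mult_mono sum_mono2) (auto intro: sum_nonneg)
    finally have \<delta>: "(norm (\<Sum>j\<in>{i..<n}. G j - a j))\<^sup>2 \<le> real n * \<Delta>" .
    have "(\<Sum>j\<in>{i..<n}. G j) = (\<Sum>j\<in>{i..<n}. G j - a j) + (\<Sum>j\<in>{i..<n}. a j)"
      by (simp add: sum_subtractf)
    then have "(norm (\<Sum>j\<in>{i..<n}. G j))\<^sup>2
        \<le> 2 * ((norm (\<Sum>j\<in>{i..<n}. G j - a j))\<^sup>2 + (norm (\<Sum>j\<in>{i..<n}. a j))\<^sup>2)"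
      using norm_add_squared_le by metis
    also have "\<dots> \<le> 2 * (real n * \<Delta> + (norm (\<Sum>j\<in>{i..<n}. a j))\<^sup>2)"
      using \<delta> by simp
    finally have "c\<^sup>2 * (norm (\<Sum>j\<in>{i..<n}. G j))\<^sup>2
        \<le> c\<^sup>2 * (2 * (real n * \<Delta> + (norm (\<Sum>j\<in>{i..<n}. a j))\<^sup>2))"
      by (intro mult_left_mono) auto
    moreover have "(norm (x' - Y i))\<^sup>2 = c\<^sup>2 * (norm (\<Sum>j\<in>{i..<n}. G j))\<^sup>2"
      using drift[of i] that by (simp add: power_mult_distrib)
    ultimately show ?thesis by (simp add: algebra_simps)
  qed
  \<comment> \<open>Since \<open>c * n\<close> is \<open>\<eta>\<close>, this is the assumption
    \<open>(L * \<eta>)\<^sup>2 \<le> \<theta> / 2\<close> multiplied by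
    \<open>\<Delta> / L\<close>.\<close>
  have gain: "\<theta> / (2 * L) * \<Delta> \<ge> L * c\<^sup>2 * ((real n)\<^sup>2 * \<Delta>)"
  proof -
    have "\<Delta> \<ge> 0" by (simp add: \<Delta>_def sum_nonneg)
    moreover have "L * \<eta>\<^sup>2 \<le> \<theta> / (2 * L)"
      using \<theta>(3) \<open>L > 0\<close> by (simp add: field_simps power2_eq_square)
    ultimately have "L * \<eta>\<^sup>2 * \<Delta> \<le> \<theta> / (2 * L) * \<Delta>"
      by (rule mult_right_mono[rotated])
    moreover have "c\<^sup>2 * (real n)\<^sup>2 = \<eta>\<^sup>2"
      using n by (simp add: c_def power_divide)
    ultimately show ?thesis by (metis mult.assoc)
  qed
  have "real n * (finite_sum_objective n f x' - (1 - \<theta>) * finite_sum_objective n f x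
           - \<theta> * finite_sum_objective n f z)
      = (\<Sum>i<n. g i x' - (1 - \<theta>) * g i x - \<theta> * g i z)"
    by (simp add: sum_subtractf objective right_diff_distrib mult.left_commute flip: sum_distrib_left)
  also have "\<dots> \<le> (\<Sum>i<n. G i \<bullet> u + L * c\<^sup>2 * (real n * \<Delta> + (norm (\<Sum>j\<in>{i..<n}. a j))\<^sup>2)
      - \<theta> / (2 * L) * (norm (G i - a i))\<^sup>2)"
  proof (rule sum_mono)
    fix i assume "i \<in> {..<n}"
    then have i: "i < n" by simp
    have "L / 2 * (norm (x' - Y i))\<^sup>2
        \<le> L / 2 * (2 * c\<^sup>2 * (real n * \<Delta> + (norm (\<Sum>j\<in>{i..<n}. a j))\<^sup>2))"
      using dist[OF i] \<open>L > 0\<close> by (intro mult_left_mono) auto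
    with step[OF i]
    show "g i x' - (1 - \<theta>) * g i x - \<theta> * g i z
        \<le> G i \<bullet> u + L * c\<^sup>2 * (real n * \<Delta> + (norm (\<Sum>j\<in>{i..<n}. a j))\<^sup>2)
          - \<theta> / (2 * L) * (norm (G i - a i))\<^sup>2"
      by simp
  qed
  also have "\<dots> = (\<Sum>i<n. G i) \<bullet> u + L * c\<^sup>2 * ((real n)\<^sup>2 * \<Delta>) + L * c\<^sup>2 * S - \<theta> / (2 * L) * \<Delta>"
    unfolding S_def \<Delta>_def
    by (simp add: sum.distrib sum_subtractf inner_sum_left flip: sum_distrib_left sum_divide_distrib)
       (simp add: algebra_simps power2_eq_square[of "real n"])
  also have "\<dots> \<le> (\<Sum>i<n. G i) \<bullet> u + L * c\<^sup>2 * S"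
    using gain by simp
  \<comment> \<open>The sampled gradients add up to the displacement of the whole epoch, which turns
    it into a single step of length \<open>\<eta>\<close>.\<close>
  also have "(\<Sum>i<n. G i) = (1 / c) *\<^sub>R (y - x')"
    using n \<open>\<eta> > 0\<close> by (simp add: x' Y c_def)
  also have "((1 / c) *\<^sub>R (y - x')) \<bullet> u + L * c\<^sup>2 * S
      = real n * ((1 / \<eta>) * ((y - x') \<bullet> u) + L * \<eta>\<^sup>2 / real n ^ 3 * S)"
    using n by (simp only: inner_scaleR_left)
      (simp add: c_def power_divide power2_eq_square power3_eq_cube distrib_left)
  finally have "finite_sum_objective n f x' - (1 - \<theta>) * finite_sum_objective n f x
           - \<theta> * finite_sum_objective n f z
      \<le> (1 / \<eta>) * ((y - x') \<bullet> u) + L * \<eta>\<^sup>2 / real n ^ 3 * S"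
    using n by (rule mult_left_le_imp_le)
  then show ?thesis
    by (simp add: u_def S_def a_def g_def)
qed

section \<open>Accelerated recursion\<close>

text \<open>Here \<open>t\<close> counts the completed epochs. The epoch bound with \<theta> = 2/(t
  + 2) is multiplied by the square of t + 2; then both factors of the inner product become
  differences of \<open>v\<close>, \<open>v'\<close> and \<open>z\<close>, and the product
  telescopes.\<close>

lemma accelerated_epoch:
  fixes f :: "nat \<Rightarrow> 'a::euclidean_space \<Rightarrow> real" and t :: nat
  assumes "L > 0" "n \<ge> 1" "\<eta> > 0" and small: "(L * \<eta>)\<^sup>2 \<le> 1 / real (t + 2)"
    and convex: "\<And>i. i \<in> {1..n} \<Longrightarrow> convex_on UNIV (f i)"
    and diff: "\<And>i x. i \<in> {1..n} \<Longrightarrow> f i differentiable (at x)"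
    and smooth: "\<And>i x y. i \<in> {1..n} \<Longrightarrow>
          norm (gradient (f i) x - gradient (f i) y) \<le> L * norm (x - y)"
    and p: "p permutes {1..n}"
    and x'_def: "x' = inner_iterate f (\<lambda>_. \<eta> / real n) p y n"
    and v_def: "v = (1 / 2) *\<^sub>R (real (t + 2) *\<^sub>R y - real t *\<^sub>R x)"
    and v'_def: "v' = (1 / 2) *\<^sub>R (real (t + 2) *\<^sub>R x' - real t *\<^sub>R x)"
  shows "(real (t + 2))\<^sup>2 * (finite_sum_objective n f x' - finite_sum_objective n f z)
      + 2 / \<eta> * (norm (v' - z))\<^sup>2
    \<le> real t * real (t + 2) * (finite_sum_objective n f x - finite_sum_objective n f z)
      + 2 / \<eta> * (norm (v - z))\<^sup>2
      + (real (t + 2))\<^sup>2 * (L * \<eta>\<^sup>2 / real n ^ 3 *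
          (\<Sum>i<n. (norm (\<Sum>j\<in>{i..<n}. gradient (f (p (Suc j))) z))\<^sup>2))"
proof -
  define s where "s = real (t + 2)"
  define R where "R = L * \<eta>\<^sup>2 / real n ^ 3 *
          (\<Sum>i<n. (norm (\<Sum>j\<in>{i..<n}. gradient (f (p (Suc j))) z))\<^sup>2)"
  define u where "u = x' - (1 - 2 / s) *\<^sub>R x - (2 / s) *\<^sub>R z"
  let ?F = "finite_sum_objective n f"
  have s: "s \<ge> 2" and t: "real t = s - 2" by (simp_all add: s_def)
  have "(L * \<eta>)\<^sup>2 \<le> 1 / s" using small by (simp only: s_def)
  \<comment> \<open>Written in the shape \<theta>/2 with \<theta> = 2/s.\<close>
  then have "(L * \<eta>)\<^sup>2 \<le> 2 / s / 2" by simp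
  then have "?F x' - (1 - 2 / s) * ?F x - (2 / s) * ?F z \<le> (1 / \<eta>) * ((y - x') \<bullet> u) + R"
    unfolding R_def u_def
    using assms(1-3) s
    by (intro epoch_descent convex diff smooth p x'_def) auto
  then have "s\<^sup>2 * (?F x' - (1 - 2 / s) * ?F x - (2 / s) * ?F z)
      \<le> s\<^sup>2 * ((1 / \<eta>) * ((y - x') \<bullet> u) + R)"
    by (rule mult_left_mono) simp
  also have "s\<^sup>2 * (?F x' - (1 - 2 / s) * ?F x - (2 / s) * ?F z)
      = s\<^sup>2 * (?F x' - ?F z) - real t * s * (?F x - ?F z)"
    using s unfolding t by (simp add: field_simps power2_eq_square)
  also have "s\<^sup>2 * ((1 / \<eta>) * ((y - x') \<bullet> u) + R) = (1 / \<eta>) * ((s *\<^sub>R (y - x')) \<bullet> (s *\<^sub>R u)) + s\<^sup>2 * R"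
    by (simp add: power2_eq_square distrib_left)
  also have "s *\<^sub>R (y - x') = 2 *\<^sub>R (v - v')"
    by (simp add: v_def v'_def s_def algebra_simps)
  also have "s *\<^sub>R u = 2 *\<^sub>R (v' - z)"
    using s by (simp add: u_def v'_def t algebra_simps flip: s_def)
  also have "(1 / \<eta>) * ((2 *\<^sub>R (v - v')) \<bullet> (2 *\<^sub>R (v' - z))) = (2 / \<eta>) * (2 * ((v - v') \<bullet> (v' - z)))"
    by simp
  \<comment> \<open>The slack is the dropped square of the distance from \<open>v\<close> to
    \<open>v'\<close>.\<close>
  also have "\<dots> \<le> (2 / \<eta>) * ((norm (v - z))\<^sup>2 - (norm (v' - z))\<^sup>2)"
  proof (rule mult_left_mono)
    have "(norm (a + b))\<^sup>2 = (norm a)\<^sup>2 + 2 * (a \<bullet> b) + (norm b)\<^sup>2" for a b :: 'a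
      by (simp add: power2_norm_eq_inner inner_add_left inner_add_right inner_commute)
    from this[of "v - v'" "v' - z"]
    show "2 * ((v - v') \<bullet> (v' - z)) \<le> (norm (v - z))\<^sup>2 - (norm (v' - z))\<^sup>2" by simp
  qed (use \<open>\<eta> > 0\<close> in simp)
  finally have "s\<^sup>2 * (?F x' - ?F z) - real t * s * (?F x - ?F z)
      \<le> (2 / \<eta>) * ((norm (v - z))\<^sup>2 - (norm (v' - z))\<^sup>2) + s\<^sup>2 * R"
    by simp
  then show ?thesis unfolding R_def s_def by (simp add: algebra_simps)
qed

text \<open>Since \<open>(t + 1) (t + 3) \<le> (t + 2)\<^sup>2\<close> and the step sizes increase, the quantity
  \<open>t (t + 2) (F x\<^sub>t - F z) + 2 / \<eta>\<^sub>t\<^sub>+\<^sub>1 \<parallel>v\<^sub>t - z\<parallel>\<^sup>2\<close> grows only by the noise; here \<open>v\<close> is the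
  auxiliary sequence of Nesterov's method, with \<open>y\<^sub>t = (1 - \<theta>) x\<^sub>t + \<theta> v\<^sub>t\<close> for \<open>\<theta> = 2 / (t + 2)\<close>.\<close>

lemma nasg_potential_le:
  fixes f :: "nat \<Rightarrow> 'a::euclidean_space \<Rightarrow> real" and t :: nat
  assumes "L > 0" "n \<ge> 1"
    and \<eta>_pos: "\<And>t. \<eta> t > 0" and \<eta>_mono: "\<And>t. \<eta> t \<le> \<eta> (Suc t)"
    and small: "\<And>t. t < T \<Longrightarrow> (L * \<eta> (Suc t))\<^sup>2 \<le> 1 / real (t + 2)"
    and convex: "\<And>i. i \<in> {1..n} \<Longrightarrow> convex_on UNIV (f i)"
    and diff: "\<And>i x. i \<in> {1..n} \<Longrightarrow> f i differentiable (at x)"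
    and smooth: "\<And>i x y. i \<in> {1..n} \<Longrightarrow>
          norm (gradient (f i) x - gradient (f i) y) \<le> L * norm (x - y)"
    and min: "\<And>w. finite_sum_objective n f z \<le> finite_sum_objective n f w"
    and \<gamma>_def: "\<And>t. \<gamma> t = (real t - 1) / (real t + 2)"
    and p: "\<And>t. t \<in> {1..T} \<Longrightarrow> \<pi> t permutes {1..n}"
    and "t \<le> T"
    and xy: "nasg n f \<gamma> (\<lambda>t i. \<eta> t / real n) x\<^sub>0 x\<^sub>0 \<pi> t = (x, y)"
  shows "real t * real (t + 2) * (finite_sum_objective n f x - finite_sum_objective n f z)
      + 2 / \<eta> (Suc t) * (norm ((1 / 2) *\<^sub>R (real (t + 2) *\<^sub>R y - real t *\<^sub>R x) - z))\<^sup>2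
    \<le> 2 / \<eta> 1 * (norm (x\<^sub>0 - z))\<^sup>2
      + (\<Sum>s<t. (real (s + 2))\<^sup>2 * (L * (\<eta> (Suc s))\<^sup>2 / real n ^ 3 *
          (\<Sum>i<n. (norm (\<Sum>j\<in>{i..<n}. gradient (f (\<pi> (Suc s) (Suc j))) z))\<^sup>2)))"
  using \<open>t \<le> T\<close> xy
proof (induction t arbitrary: x y)
  case 0
  \<comment> \<open>At the start the function-value term has factor 0, and the auxiliary point is
    \<open>x\<^sub>0\<close> because both initial points coincide.\<close>
  then show ?case by auto
next
  case (Suc t x' y')
  obtain x y where xy: "nasg n f \<gamma> (\<lambda>t i. \<eta> t / real n) x\<^sub>0 x\<^sub>0 \<pi> t = (x, y)"
    by (cases "nasg n f \<gamma> (\<lambda>t i. \<eta> t / real n) x\<^sub>0 x\<^sub>0 \<pi> t")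
  let ?F = "finite_sum_objective n f"
  let ?R = "\<lambda>s. (real (s + 2))\<^sup>2 * (L * (\<eta> (Suc s))\<^sup>2 / real n ^ 3 *
          (\<Sum>i<n. (norm (\<Sum>j\<in>{i..<n}. gradient (f (\<pi> (Suc s) (Suc j))) z))\<^sup>2))"
  define v where "v = (1 / 2) *\<^sub>R (real (t + 2) *\<^sub>R y - real t *\<^sub>R x)"
  define v' where "v' = (1 / 2) *\<^sub>R (real (t + 2) *\<^sub>R x' - real t *\<^sub>R x)"
  have x': "x' = inner_iterate f (\<lambda>_. \<eta> (Suc t) / real n) (\<pi> (Suc t)) y n"
    and y': "y' = x' + \<gamma> (Suc t) *\<^sub>R (x' - x)"
    using Suc.prems(2) by (auto simp: xy Let_def)
  \<comment> \<open>The momentum t/(t + 3) is the value for which the auxiliary point of the new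
    pair, taken with index t + 1, is the \<open>v'\<close> reached by this epoch.\<close>
  have v'_eq: "(1 / 2) *\<^sub>R (real (Suc t + 2) *\<^sub>R y' - real (Suc t) *\<^sub>R x') = v'"
  proof -
    have "real (Suc t + 2) *\<^sub>R y' = real (Suc t + 2) *\<^sub>R x' + (real (Suc t + 2) * \<gamma> (Suc t)) *\<^sub>R (x' - x)"
      unfolding y' by (simp add: scaleR_add_right)
    also have "real (Suc t + 2) * \<gamma> (Suc t) = real t" by (simp add: \<gamma>_def)
    finally have "real (Suc t + 2) *\<^sub>R y' - real (Suc t) *\<^sub>R x' = real (t + 2) *\<^sub>R x' - real t *\<^sub>R x"
      using scaleR_left_distrib[of 1 2 x', simplified] by (simp add: algebra_simps)
    then show ?thesis by (simp only: v'_def)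
  qed
  have "real (Suc t) * real (Suc t + 2) * (?F x' - ?F z) \<le> (real (t + 2))\<^sup>2 * (?F x' - ?F z)"
    using min[of x'] by (intro mult_right_mono) (auto simp: power2_eq_square algebra_simps)
  moreover have "2 / \<eta> (Suc (Suc t)) * (norm (v' - z))\<^sup>2 \<le> 2 / \<eta> (Suc t) * (norm (v' - z))\<^sup>2"
    using \<eta>_pos \<eta>_mono[of "Suc t"] by (intro mult_right_mono divide_left_mono) auto
  moreover have "(real (t + 2))\<^sup>2 * (?F x' - ?F z) + 2 / \<eta> (Suc t) * (norm (v' - z))\<^sup>2
      \<le> real t * real (t + 2) * (?F x - ?F z) + 2 / \<eta> (Suc t) * (norm (v - z))\<^sup>2 + ?R t"
    using Suc.prems(1)
    by (intro accelerated_epoch[where y = y] assms(1,2) \<eta>_pos small convex diff smooth p x' v_def v'_def) auto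
  moreover have "real t * real (t + 2) * (?F x - ?F z) + 2 / \<eta> (Suc t) * (norm (v - z))\<^sup>2
      \<le> 2 / \<eta> 1 * (norm (x\<^sub>0 - z))\<^sup>2 + (\<Sum>s<t. ?R s)"
    unfolding v_def using Suc.prems(1) by (intro Suc.IH xy) simp
  ultimately show ?case
    unfolding v'_eq sum.lessThan_Suc by linarith
qed

section \<open>Shuffling schemes\<close>

lemma finite_set_pmf_shuffling_law: "finite (set_pmf (shuffling_law scheme n T))"
proof (cases scheme)
  case Random_Reshuffling
  then show ?thesis
    by (auto simp: set_Pi_pmf finite_set_pmf_uniform_permutation intro!: finite_PiE_dflt)
next
  case Single_Shuffling
  then show ?thesis by (simp add: finite_set_pmf_uniform_permutation)
qed

text \<open>Dependence between epochs never enters, because the noise is a sum of terms that each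
  involve one epoch; hence this marginal suffices. Outside \<open>{1..T}\<close> the reshuffling law
  takes the default \<open>id\<close>.\<close>

lemma map_pmf_component_shuffling_law:
  "t \<in> {1..T} \<Longrightarrow> map_pmf (\<lambda>\<pi>. \<pi> t) (shuffling_law scheme n T) = uniform_permutation n"
  by (cases scheme) (auto simp: Pi_pmf_component map_pmf_comp)

lemma shuffling_law_permutes:
  assumes "\<pi> \<in> set_pmf (shuffling_law scheme n T)" "t \<in> {1..T}"
  shows "\<pi> t permutes {1..n}"
proof -
  have "\<pi> t \<in> set_pmf (map_pmf (\<lambda>\<pi>. \<pi> t) (shuffling_law scheme n T))"
    using assms(1) by simp
  then show ?thesis
    unfolding map_pmf_component_shuffling_law[OF assms(2)] by (simp add: set_pmf_uniform_permutation)
qed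

lemma integrable_shuffling_law:
  fixes g :: "(nat \<Rightarrow> nat \<Rightarrow> nat) \<Rightarrow> real"
  shows "integrable (measure_pmf (shuffling_law scheme n T)) g"
  by (rule integrable_measure_pmf_finite[OF finite_set_pmf_shuffling_law])

lemma expectation_shuffling_law_component:
  fixes g :: "(nat \<Rightarrow> nat) \<Rightarrow> real"
  assumes "t \<in> {1..T}"
  shows "measure_pmf.expectation (shuffling_law scheme n T) (\<lambda>\<pi>. g (\<pi> t))
       = measure_pmf.expectation (uniform_permutation n) g"
  by (metis integral_map_pmf map_pmf_component_shuffling_law[OF assms])

section \<open>Step-size bounds, averaged noise and the final constants\<close>

theorem theorem4p5:
  fixes f :: "nat \<Rightarrow> real ^ 'd \<Rightarrow> real"
    and F :: "real ^ 'd \<Rightarrow> real"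
    and n T :: nat
    and L \<alpha> k :: real
    and \<gamma> \<eta> :: "nat \<Rightarrow> real"
    and x\<^sub>0 xstar :: "real ^ 'd"
    and scheme :: shuffling_scheme
  assumes "L > 0" and "n \<ge> 1"
    and convex: "\<And>i. i \<in> {1..n} \<Longrightarrow> convex_on UNIV (f i)"
    and differentiable: "\<And>i x. i \<in> {1..n} \<Longrightarrow> f i differentiable (at x)"
    and smooth: "\<And>i x y. i \<in> {1..n} \<Longrightarrow>
          norm (gradient (f i) x - gradient (f i) y) \<le> L * norm (x - y)"
    and F_def: "F = finite_sum_objective n f"
    and minimizer: "\<And>w. F xstar \<le> F w"
    and "T \<ge> 2"
    and \<alpha>_def: "\<alpha> = 1 + 1 / real T"
    and k_def: "k = 1 / (exp 1 * \<alpha> * root 3 12)"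
    and \<gamma>_def: "\<And>t. \<gamma> t = (real t - 1) / (real t + 2)"
    and \<eta>_def: "\<And>t. \<eta> t = k * \<alpha> ^ t / (L * real T)"
  shows "(\<forall>t \<in> {1..T}. 0 < \<eta> t / real n \<and> \<eta> t \<le> 1 / L) \<and>
    measure_pmf.expectation (shuffling_law scheme n T)
      (\<lambda>\<pi>. F (fst (nasg n f \<gamma> (\<lambda>t i. \<eta> t / real n) x\<^sub>0 x\<^sub>0 \<pi> T)) - F xstar)
    \<le> 8 * gradient_variance n f xstar / (27 * real n * L * real T)
      + 2 * L * exp 1 * root 3 12 / real T * (norm (x\<^sub>0 - xstar))\<^sup>2"
proof (intro conjI ballI)
  define c where "c = root 3 12"
  have "root 3 8 \<le> root 3 (12::real)" by (intro real_root_le_mono) auto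
  moreover have "root 3 8 = (2::real)" by (rule real_root_pos_unique) auto
  ultimately have c: "c \<ge> 2" by (simp add: c_def)
  have T: "real T \<ge> 2" using \<open>T \<ge> 2\<close> by simp
  have n: "real n \<ge> 1" using \<open>n \<ge> 1\<close> by simp
  have \<alpha>: "\<alpha> \<ge> 1" by (simp add: \<alpha>_def)
  have k_pos: "k > 0" using \<alpha> c by (simp add: k_def flip: c_def)
  have \<eta>_pos: "\<eta> t > 0" for t
    using k_pos \<alpha> T \<open>L > 0\<close> by (simp add: \<eta>_def)
  have \<eta>_mono: "\<eta> t \<le> \<eta> (Suc t)" for t
    unfolding \<eta>_def using k_pos \<alpha> T \<open>L > 0\<close>
    by (intro divide_right_mono mult_left_mono power_increasing) auto
  \<comment> \<open>Growth over all epochs costs at most a factor e, which \<open>k\<close> cancels;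
    \<open>c\<close> at least 2 supplies the 2.\<close>
  have \<eta>_le: "\<eta> t \<le> 1 / (2 * L * real T)" if "t \<in> {1..T}" for t
  proof -
    have "\<alpha> ^ t \<le> exp (1 / real T) ^ t"
      unfolding \<alpha>_def by (intro power_mono exp_ge_add_one_self) auto
    also have "\<dots> = exp (real t / real T)" by (simp flip: exp_of_nat_mult)
    also have "\<dots> \<le> exp 1" using that by (simp add: divide_le_eq)
    finally have "k * \<alpha> ^ t \<le> k * exp 1" using k_pos by (intro mult_left_mono) auto
    also have "\<dots> = 1 / (\<alpha> * c)" by (simp add: k_def c_def)
    also have "\<dots> \<le> 1 / (1 * 2)"
      using \<alpha> c by (intro divide_left_mono mult_mono) auto
    finally have "k * \<alpha> ^ t \<le> 1 / 2" by simp
    then have "k * \<alpha> ^ t / (L * real T) \<le> (1 / 2) / (L * real T)"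
      using T \<open>L > 0\<close> by (intro divide_right_mono) auto
    then show ?thesis by (simp add: \<eta>_def mult_ac)
  qed
  {
    fix t assume t: "t \<in> {1..T}"
    show "0 < \<eta> t / real n" using \<eta>_pos[of t] n by simp
    note \<eta>_le[OF t]
    also have "1 / (2 * L * real T) \<le> 1 / L"
      using T \<open>L > 0\<close> by (intro divide_left_mono) auto
    finally show "\<eta> t \<le> 1 / L" .
  next
    define V where "V = gradient_variance n f xstar"
    define D where "D = (norm (x\<^sub>0 - xstar))\<^sup>2"
    define S where "S = (\<lambda>p. \<Sum>i<n. (norm (\<Sum>j\<in>{i..<n}. gradient (f (p (Suc j))) xstar))\<^sup>2)"
    define w where "w = (\<lambda>s. (real (s + 2))\<^sup>2 * (L * (\<eta> (Suc s))\<^sup>2 / real n ^ 3))"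
    define X where "X = (\<lambda>\<pi>. fst (nasg n f \<gamma> (\<lambda>t i. \<eta> t / real n) x\<^sub>0 x\<^sub>0 \<pi> T))"
    let ?E = "measure_pmf.expectation (shuffling_law scheme n T)"
    have V: "V \<ge> 0" by (simp add: V_def gradient_variance_def sum_nonneg)
    have D: "D \<ge> 0" by (simp add: D_def)
    have min: "finite_sum_objective n f xstar \<le> finite_sum_objective n f w" for w
      using minimizer F_def by simp
    have small: "(L * \<eta> (Suc t))\<^sup>2 \<le> 1 / real (t + 2)" if "t < T" for t
    proof -
      \<comment> \<open>Hence the square is at most 1/(4 T T), while t + 2 is only of order
        T.\<close>
      have "L * \<eta> (Suc t) \<le> L * (1 / (2 * L * real T))"
        using \<eta>_le[of "Suc t"] that \<open>L > 0\<close> by (intro mult_left_mono) auto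
      then have "(L * \<eta> (Suc t))\<^sup>2 \<le> (1 / (2 * real T))\<^sup>2"
        using \<eta>_pos[of "Suc t"] \<open>L > 0\<close> by (intro power_mono) auto
      also have "\<dots> = 1 / (4 * real T * real T)" by (simp add: power2_eq_square)
      also have "\<dots> \<le> 1 / real (t + 2)"
      proof (rule divide_left_mono)
        have "real (t + 2) \<le> real T + 1" using that by simp
        also have "\<dots> \<le> 4 * real T * 1" using T by simp
        also have "\<dots> \<le> 4 * real T * real T" using T by (intro mult_left_mono) auto
        finally show "real (t + 2) \<le> 4 * real T * real T" .
      qed (use T in auto)
      finally show ?thesis .
    qed
    have pointwise: "F (X \<pi>) - F xstar
        \<le> (2 / \<eta> 1 * D + (\<Sum>s<T. w s * S (\<pi> (Suc s)))) / (real T * (real T + 2))"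
      if \<pi>: "\<pi> \<in> set_pmf (shuffling_law scheme n T)" for \<pi>
    proof -
      let ?y = "snd (nasg n f \<gamma> (\<lambda>t i. \<eta> t / real n) x\<^sub>0 x\<^sub>0 \<pi> T)"
      have "real T * real (T + 2) * (F (X \<pi>) - F xstar)
          + 2 / \<eta> (Suc T) * (norm ((1 / 2) *\<^sub>R (real (T + 2) *\<^sub>R ?y - real T *\<^sub>R X \<pi>) - xstar))\<^sup>2
          \<le> 2 / \<eta> 1 * D + (\<Sum>s<T. w s * S (\<pi> (Suc s)))"
        unfolding F_def X_def D_def w_def S_def mult.assoc[of "_\<^sup>2"]
        by (rule nasg_potential_le[OF \<open>L > 0\<close> \<open>n \<ge> 1\<close> \<eta>_pos \<eta>_mono small convex differentiable
              smooth min \<gamma>_def shuffling_law_permutes[OF \<pi>] order_refl]) auto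
      \<comment> \<open>The distance part of the final potential is discarded.\<close>
      moreover have "2 / \<eta> (Suc T) * (norm ((1 / 2) *\<^sub>R (real (T + 2) *\<^sub>R ?y - real T *\<^sub>R X \<pi>) - xstar))\<^sup>2 \<ge> 0"
        using \<eta>_pos[of "Suc T"] by simp
      ultimately have "real T * real (T + 2) * (F (X \<pi>) - F xstar)
          \<le> 2 / \<eta> 1 * D + (\<Sum>s<T. w s * S (\<pi> (Suc s)))" by linarith
      then show ?thesis using T by (simp add: pos_le_divide_eq mult.commute add.commute)
    qed
    have noise: "?E (\<lambda>\<pi>. \<Sum>s<T. w s * S (\<pi> (Suc s))) \<le> (real T + 1)\<^sup>2 / (4 * L * real T * real n) * V"
    proof -
      have "?E (\<lambda>\<pi>. \<Sum>s<T. w s * S (\<pi> (Suc s))) = (\<Sum>s<T. w s * ?E (\<lambda>\<pi>. S (\<pi> (Suc s))))"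
        by (simp add: Bochner_Integration.integral_sum integrable_shuffling_law)
      \<comment> \<open>The index gives s + 2 at most T + 1. The tail bound contributes the square
        of \<open>n\<close> against the cube in the weight, leaving 1/n.\<close>
      also have "\<dots> \<le> (\<Sum>s<T. ((real T + 1)\<^sup>2 * (1 / (4 * L * (real T)\<^sup>2 * real n ^ 3))) * ((real n)\<^sup>2 * V))"
      proof (intro sum_mono mult_mono)
        fix s assume "s \<in> {..<T}"
        then have s: "Suc s \<in> {1..T}" by auto
        have "(\<eta> (Suc s))\<^sup>2 \<le> (1 / (2 * L * real T))\<^sup>2"
          using \<eta>_le[OF s] \<eta>_pos[of "Suc s"] by (intro power_mono) auto
        then have "L * (\<eta> (Suc s))\<^sup>2 / real n ^ 3 \<le> L * (1 / (2 * L * real T))\<^sup>2 / real n ^ 3"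
          using \<open>L > 0\<close> by (intro divide_right_mono mult_left_mono) auto
        also have "\<dots> = 1 / (4 * L * (real T)\<^sup>2 * real n ^ 3)"
          using \<open>L > 0\<close> by (simp add: power_divide power_mult_distrib power2_eq_square)
        finally have *: "L * (\<eta> (Suc s))\<^sup>2 / real n ^ 3 \<le> 1 / (4 * L * (real T)\<^sup>2 * real n ^ 3)" .
        show "w s \<le> (real T + 1)\<^sup>2 * (1 / (4 * L * (real T)\<^sup>2 * real n ^ 3))"
          unfolding w_def using s \<open>L > 0\<close> by (intro mult_mono power_mono *) auto
        have "?E (\<lambda>\<pi>. S (\<pi> (Suc s))) = measure_pmf.expectation (uniform_permutation n) S"
          by (rule expectation_shuffling_law_component[OF s])
        also have "\<dots> \<le> (real n)\<^sup>2 * V"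
          unfolding S_def V_def gradient_variance_def
          by (rule expectation_tail_sums_permutation_le
              [OF sum_gradient_minimizer_eq_0[OF \<open>n \<ge> 1\<close> differentiable min]])
        finally show "?E (\<lambda>\<pi>. S (\<pi> (Suc s))) \<le> (real n)\<^sup>2 * V" .
        show "0 \<le> ?E (\<lambda>\<pi>. S (\<pi> (Suc s)))"
          by (intro integral_nonneg_AE) (auto simp: S_def sum_nonneg)
        show "0 \<le> (real T + 1)\<^sup>2 * (1 / (4 * L * (real T)\<^sup>2 * real n ^ 3))"
          using \<open>L > 0\<close> by simp
      qed
      also have "\<dots> = (real T + 1)\<^sup>2 / (4 * L * real T * real n) * V"
        using T n \<open>L > 0\<close> by (simp add: power2_eq_square power3_eq_cube field_simps)
      finally show ?thesis .
    qed
    have "?E (\<lambda>\<pi>. F (X \<pi>) - F xstar)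
        \<le> ?E (\<lambda>\<pi>. (2 / \<eta> 1 * D + (\<Sum>s<T. w s * S (\<pi> (Suc s)))) / (real T * (real T + 2)))"
      using pointwise by (intro integral_mono_AE integrable_shuffling_law) (simp add: AE_measure_pmf_iff)
    also have "\<dots> = (2 / \<eta> 1 * D + ?E (\<lambda>\<pi>. \<Sum>s<T. w s * S (\<pi> (Suc s)))) / (real T * (real T + 2))"
      by (simp add: integrable_shuffling_law del: Bochner_Integration.integral_sum)
    also have "\<dots> \<le> (2 / \<eta> 1 * D + (real T + 1)\<^sup>2 / (4 * L * real T * real n) * V) / (real T * (real T + 2))"
      using noise T by (intro divide_right_mono) auto
    also have "\<dots> = (2 / \<eta> 1 * D) / (real T * (real T + 2))
        + V / (n * L * real T) * ((real T + 1)\<^sup>2 / (4 * (real T * (real T + 2))))"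
      by (simp add: add_divide_distrib mult_ac)
    also have "\<dots> \<le> 2 * L * exp 1 * c / real T * D + V / (n * L * real T) * (8 / 27)"
    proof (intro add_mono mult_left_mono)
      \<comment> \<open>The factor 1/\<alpha> in \<open>k\<close> cancels the single power of
        \<alpha> in \<open>\<eta> 1\<close>.\<close>
      have "2 / \<eta> 1 = real T * (2 * L * exp 1 * c)"
        using \<alpha> T c \<open>L > 0\<close> by (simp add: \<eta>_def k_def flip: c_def)
      then have "(2 / \<eta> 1 * D) / (real T * (real T + 2)) = 2 * L * exp 1 * c * D / (real T + 2)"
        using T by simp
      also have "\<dots> \<le> 2 * L * exp 1 * c * D / real T"
        using T c D \<open>L > 0\<close> by (intro divide_left_mono) auto
      finally show "(2 / \<eta> 1 * D) / (real T * (real T + 2)) \<le> 2 * L * exp 1 * c / real T * D" by simp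
      \<comment> \<open>The ratio of the square of T + 1 to T (T + 2) is 1 + 1/(T (T + 2)), at most
        9/8 for T at least 2 and so below 32/27; a quarter of 32/27 is 8/27.\<close>
      have "2 * 2 \<le> real T * real T" using T by (intro mult_mono) auto
      then have "27 * (real T + 1)\<^sup>2 \<le> 32 * (real T * (real T + 2))"
        using T by (simp add: power2_eq_square algebra_simps)
      then show "(real T + 1)\<^sup>2 / (4 * (real T * (real T + 2))) \<le> 8 / 27"
        using T by (simp add: divide_le_eq)
      show "0 \<le> V / (n * L * real T)" using V \<open>L > 0\<close> by simp
    qed
    finally show "?E (\<lambda>\<pi>. F (fst (nasg n f \<gamma> (\<lambda>t i. \<eta> t / real n) x\<^sub>0 x\<^sub>0 \<pi> T)) - F xstar)
      \<le> 8 * gradient_variance n f xstar / (27 * real n * L * real T)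
        + 2 * L * exp 1 * root 3 12 / real T * (norm (x\<^sub>0 - xstar))\<^sup>2"
      by (simp add: X_def V_def D_def c_def mult_ac)
  }
qed

end
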